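(* Consider the following two constructions. (i) To an ordered Ehresmann semigroup $(S,\cdot,D,R,\leq)$ assign the Ehresmann-ordered category $\mathcal{C}(S)=(S,\circ,D,R,\leq)$, where $s\circ t$ is defined if and only if $R(s)=D(t)$, in which case $s\circ t=st$. (ii) To an Ehresmann-ordered category $(C,\circ,D,R,\leq)$ assign the ordered Ehresmann semigroup $(C,\otimes,D,R,\leq)$, where $s\otimes t=\bigl(s|(R(s)\wedge D(t))\bigr)\circ\bigl((R(s)\wedge D(t))|t\bigr)$ for all $s,t\in C$. These two constructions are mutually inverse, and indeed there is a category isomorphism between the category of ordered Ehresmann semigroups (with ordered Ehresmann semigroup homomorphisms as arrows) and the category of Ehresmann-ordered categories (with morphisms of Ehresmann-ordered categories as arrows).
   Context: An Ehresmann semigroup is a semigroup $(S,\cdot)$ with unary operations $D,R$ such that for all $s,t\in S$: $D(s)s=s$, $sR(s)=s$; $D(R(s))=R(s)$, $R(D(s))=D(s)$; $D(st)=D(sD(t))$, $R(st)=R(R(s)t)$; $D(D(s)D(t))=D(s)D(t)$; $D(s)D(t)=D(t)D(s)$. Put $D(S)=\{D(s)\mid s\in S\}=R(S)$. An ordered Ehresmann semigroup $(S,\cdot,D,R,\leq)$ is an Ehresmann semigroup with a partial order $\leq$ on $S$ such that: $a\leq b$ implies $D(a)\leq D(b)$ and $R(a)\leq R(b)$; $a\leq b$ and $c\leq d$ imply $ac\leq bd$; $ae\leq a$ and $ea\leq a$ for all $a\in S$, $e\in D(S)$; and if $a\in S$, $e\in D(S)$ and $a\leq e$ then $a\in D(S)$.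 An ordered Ehresmann semigroup homomorphism is a semigroup homomorphism $F:S\to T$ with $D(s)F=D(sF)$, $R(s)F=R(sF)$ for all $s\in S$, and such that $s\leq t$ implies $sF\leq tF$. (Functions are written on the right.) A (small) category is a partial algebra $(C,\circ,D,R)$ with $\circ$ a partial binary operation and $D,R$ unary operations such that for all $x,y,z\in C$: $D(x)\circ x=x=x\circ R(x)$; $D(R(x))=R(x)$, $R(D(x))=D(x)$; $x\circ y$ is defined iff $R(x)=D(y)$; if $x\circ y$ is defined then $D(x\circ y)=D(x)$ and $R(x\circ y)=R(y)$; if $(x\circ y)\circ z$ and $x\circ(y\circ z)$ are defined they are equal. $D(C)=\{D(x)\mid x\in C\}=R(C)$ is the set of identities. An $\Omega$-structured category $(C,\circ,D,R,\leq)$ is a category with a partial order $\leq$ on $C$ such that $a\leq b$ implies $D(a)\leq D(b)$ and $R(a)\leq R(b)$; and if $a\leq b$, $c\leq d$ and both $a\circ c$, $b\circ d$ exist, then $a\circ c\leq b\circ d$. An Ehresmann-ordered category is an $\Omega$-structured category $(C,\circ,D,R,\leq)$ such that: (OC6) for all $x\in C$ and $e\in D(C)$ with $e\leq D(x)$, there is a greatest element $e|x=\max\{y\leq x\mid D(y)\leq e\}$, and $D(e|x)=e$; and for all $x\in C$ and $e\in D(C)$ with $e\leq R(x)$, there is a greatest element $x|e=\max\{y\leq x\mid R(y)\leq e\}$, and $R(x|e)=e$; (OC7') if $a\leq b\circ c$, then there are $b'\leq b$, $c'\leq c$ such that $D(a)=D(b')$, $R(a)=R(c')$, $b'\circ c'$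 exists, and $a\leq b'\circ c'$; (OCI) if $a\in C$ and $a\leq e\in D(C)$, then $a\in D(C)$; and $(D(C),\leq)$ is a meet-semilattice (with meet $\wedge$). A morphism of Ehresmann-ordered categories $F:C_1\to C_2$ is a functor (a map preserving $D$, $R$ and all existing products $\circ$) such that: $s\leq t$ implies $sF\leq tF$; $(e\wedge f)F=eF\wedge fF$ for $e,f\in D(C_1)$; if $s\in C_1$, $e\in D(C_1)$ and $e\leq D(s)$ then $(e|s)F=(eF)|(sF)$, and dually if $f\in D(C_1)$ and $f\leq R(s)$ then $(s|f)F=(sF)|(fF)$. *)

theory Defs
  imports Main "HOL-Library.FuncSet"
begin

text \<open>
  All structures live on a carrier set inside an arbitrary type.  Total operations are extensional
  (they are \<^const>\<open>undefined\<close> off the carrier), partial products are \<^const>\<open>None\<close> where they are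
  not defined, and orders relate only elements of the carrier; hence two structures are the same
  mathematical object iff the records are equal.  Carriers may be empty.
\<close>

record 'a biunary =
  carrier :: "'a set"
  D :: "'a \<Rightarrow> 'a"
  R :: "'a \<Rightarrow> 'a"

record 'a biunary_semigroup = "'a biunary" +
  mult :: "'a \<Rightarrow> 'a \<Rightarrow> 'a"  (infixl "\<cdot>\<index>" 70)

record 'a ordered_semigroup = "'a biunary_semigroup" +
  sle :: "'a \<Rightarrow> 'a \<Rightarrow> bool"  (infix "\<preceq>\<index>" 50)

record 'a cat = "'a biunary" +
  prd :: "'a \<Rightarrow> 'a \<Rightarrow> 'a option"  (infixl "\<odot>\<index>" 70)

record 'a ordered_cat = "'a cat" +
  cle :: "'a \<Rightarrow> 'a \<Rightarrow> bool"  (infix "\<sqsubseteq>\<index>" 50)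

definition identities :: "('a, 'm) biunary_scheme \<Rightarrow> 'a set" where
  "identities S = D S ` carrier S"

locale biunary_algebra =
  fixes S :: "('a, 'm) biunary_scheme" (structure)
  assumes D_closed: "D S \<in> carrier S \<rightarrow>\<^sub>E carrier S"
    and R_closed: "R S \<in> carrier S \<rightarrow>\<^sub>E carrier S"


section \<open>Ordered Ehresmann semigroups\<close>

locale ehresmann_semigroup = biunary_algebra S
  for S :: "('a, 'm) biunary_semigroup_scheme" (structure) +
  assumes mult_closed: "mult S \<in> carrier S \<rightarrow>\<^sub>E (carrier S \<rightarrow>\<^sub>E carrier S)"
    and mult_assoc: "\<lbrakk>s \<in> carrier S; t \<in> carrier S; u \<in> carrier S\<rbrakk>
          \<Longrightarrow> (s \<cdot> t) \<cdot> u = s \<cdot> (t \<cdot> u)"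
    and D_left: "s \<in> carrier S \<Longrightarrow> D S s \<cdot> s = s"
    and R_right: "s \<in> carrier S \<Longrightarrow> s \<cdot> R S s = s"
    and D_R: "s \<in> carrier S \<Longrightarrow> D S (R S s) = R S s"
    and R_D: "s \<in> carrier S \<Longrightarrow> R S (D S s) = D S s"
    and D_mult: "\<lbrakk>s \<in> carrier S; t \<in> carrier S\<rbrakk> \<Longrightarrow> D S (s \<cdot> t) = D S (s \<cdot> D S t)"
    and R_mult: "\<lbrakk>s \<in> carrier S; t \<in> carrier S\<rbrakk> \<Longrightarrow> R S (s \<cdot> t) = R S (R S s \<cdot> t)"
    and D_D_mult: "\<lbrakk>s \<in> carrier S; t \<in> carrier S\<rbrakk>
          \<Longrightarrow> D S (D S s \<cdot> D S t) = D S s \<cdot> D S t"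
    and D_commute: "\<lbrakk>s \<in> carrier S; t \<in> carrier S\<rbrakk> \<Longrightarrow> D S s \<cdot> D S t = D S t \<cdot> D S s"

locale ordered_ehresmann_semigroup = ehresmann_semigroup S
  for S :: "('a, 'm) ordered_semigroup_scheme" (structure) +
  assumes order: "partial_order_on (carrier S) {(a, b). a \<preceq> b}"
    and D_mono: "a \<preceq> b \<Longrightarrow> D S a \<preceq> D S b"
    and R_mono: "a \<preceq> b \<Longrightarrow> R S a \<preceq> R S b"
    and mult_mono: "\<lbrakk>a \<preceq> b; c \<preceq> d\<rbrakk> \<Longrightarrow> a \<cdot> c \<preceq> b \<cdot> d"
    and mult_identity_right: "\<lbrakk>a \<in> carrier S; e \<in> identities S\<rbrakk> \<Longrightarrow> a \<cdot> e \<preceq> a"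
    and mult_identity_left: "\<lbrakk>a \<in> carrier S; e \<in> identities S\<rbrakk> \<Longrightarrow> e \<cdot> a \<preceq> a"
    and below_identity: "\<lbrakk>a \<in> carrier S; e \<in> identities S; a \<preceq> e\<rbrakk> \<Longrightarrow> a \<in> identities S"

definition ordered_ehresmann_hom ::
    "('a, 'm) ordered_semigroup_scheme \<Rightarrow> ('b, 'n) ordered_semigroup_scheme \<Rightarrow> ('a \<Rightarrow> 'b) \<Rightarrow> bool"
  where
  "ordered_ehresmann_hom S T F \<longleftrightarrow>
     F \<in> carrier S \<rightarrow> carrier T \<and>
     (\<forall>s\<in>carrier S. \<forall>t\<in>carrier S. F (s \<cdot>\<^bsub>S\<^esub> t) = F s \<cdot>\<^bsub>T\<^esub> F t) \<and>
     (\<forall>s\<in>carrier S. F (D S s) = D T (F s) \<and> F (R S s) = R T (F s)) \<and>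
     (\<forall>s t. s \<preceq>\<^bsub>S\<^esub> t \<longrightarrow> F s \<preceq>\<^bsub>T\<^esub> F t)"


section \<open>Categories and functors\<close>

text \<open>
  Categories are one-sorted: the elements are the arrows, the identities play the role of objects,
  and products are written in diagrammatic order.
\<close>

locale category = biunary_algebra C
  for C :: "('a, 'm) cat_scheme" (structure) +
  assumes prd_closed: "x \<odot> y = Some z \<Longrightarrow> z \<in> carrier C"
    and prd_defined: "x \<odot> y \<noteq> None \<longleftrightarrow> x \<in> carrier C \<and> y \<in> carrier C \<and> R C x = D C y"
    and D_prd_left: "x \<in> carrier C \<Longrightarrow> D C x \<odot> x = Some x"
    and R_prd_right: "x \<in> carrier C \<Longrightarrow> x \<odot> R C x = Some x"
    and D_R: "x \<in> carrier C \<Longrightarrow> D C (R C x) = R C x"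
    and R_D: "x \<in> carrier C \<Longrightarrow> R C (D C x) = D C x"
    and D_prd: "x \<odot> y = Some z \<Longrightarrow> D C z = D C x"
    and R_prd: "x \<odot> y = Some z \<Longrightarrow> R C z = R C y"
    and prd_assoc: "\<lbrakk>x \<odot> y = Some xy; xy \<odot> z = Some u; y \<odot> z = Some yz; x \<odot> yz = Some v\<rbrakk>
          \<Longrightarrow> u = v"

definition category_functor ::
    "('a, 'm) cat_scheme \<Rightarrow> ('b, 'n) cat_scheme \<Rightarrow> ('a \<Rightarrow> 'b) \<Rightarrow> bool" where
  "category_functor C1 C2 F \<longleftrightarrow>
     category C1 \<and> category C2 \<and>
     F \<in> carrier C1 \<rightarrow> carrier C2 \<and>
     (\<forall>x\<in>carrier C1. F (D C1 x) = D C2 (F x) \<and> F (R C1 x) = R C2 (F x)) \<and>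
     (\<forall>x y z. x \<odot>\<^bsub>C1\<^esub> y = Some z \<longrightarrow> F x \<odot>\<^bsub>C2\<^esub> F y = Some (F z))"

definition category_isomorphism ::
    "('a, 'm) cat_scheme \<Rightarrow> ('b, 'n) cat_scheme \<Rightarrow> ('a \<Rightarrow> 'b) \<Rightarrow> bool" where
  "category_isomorphism C1 C2 F \<longleftrightarrow>
     category_functor C1 C2 F \<and>
     (\<exists>G. category_functor C2 C1 G \<and>
          (\<forall>x\<in>carrier C1. G (F x) = x) \<and> (\<forall>y\<in>carrier C2. F (G y) = y))"


section \<open>Ehresmann-ordered categories\<close>

definition is_greatest :: "('a \<Rightarrow> 'a \<Rightarrow> bool) \<Rightarrow> 'a set \<Rightarrow> 'a \<Rightarrow> bool" where
  "is_greatest le A m \<longleftrightarrow> m \<in> A \<and> (\<forall>y\<in>A. le y m)"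

definition greatest :: "('a \<Rightarrow> 'a \<Rightarrow> bool) \<Rightarrow> 'a set \<Rightarrow> 'a" where
  "greatest le A = (THE m. is_greatest le A m)"

definition below_D :: "('a, 'm) ordered_cat_scheme \<Rightarrow> 'a \<Rightarrow> 'a \<Rightarrow> 'a set" where
  "below_D C e x = {y \<in> carrier C. y \<sqsubseteq>\<^bsub>C\<^esub> x \<and> D C y \<sqsubseteq>\<^bsub>C\<^esub> e}"

definition below_R :: "('a, 'm) ordered_cat_scheme \<Rightarrow> 'a \<Rightarrow> 'a \<Rightarrow> 'a set" where
  "below_R C x e = {y \<in> carrier C. y \<sqsubseteq>\<^bsub>C\<^esub> x \<and> R C y \<sqsubseteq>\<^bsub>C\<^esub> e}"

text \<open>\<open>restrict_D C e x\<close> is \<open>e|x\<close> and \<open>restrict_R C x e\<close> is \<open>x|e\<close>.\<close>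

definition restrict_D :: "('a, 'm) ordered_cat_scheme \<Rightarrow> 'a \<Rightarrow> 'a \<Rightarrow> 'a" where
  "restrict_D C e x = greatest (cle C) (below_D C e x)"

definition restrict_R :: "('a, 'm) ordered_cat_scheme \<Rightarrow> 'a \<Rightarrow> 'a \<Rightarrow> 'a" where
  "restrict_R C x e = greatest (cle C) (below_R C x e)"

definition lower_identities :: "('a, 'm) ordered_cat_scheme \<Rightarrow> 'a \<Rightarrow> 'a \<Rightarrow> 'a set" where
  "lower_identities C e f = {g \<in> identities C. g \<sqsubseteq>\<^bsub>C\<^esub> e \<and> g \<sqsubseteq>\<^bsub>C\<^esub> f}"

definition meet :: "('a, 'm) ordered_cat_scheme \<Rightarrow> 'a \<Rightarrow> 'a \<Rightarrow> 'a" where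
  "meet C e f = greatest (cle C) (lower_identities C e f)"

locale omega_structured_category = category C
  for C :: "('a, 'm) ordered_cat_scheme" (structure) +
  assumes order: "partial_order_on (carrier C) {(a, b). a \<sqsubseteq> b}"
    and D_mono: "a \<sqsubseteq> b \<Longrightarrow> D C a \<sqsubseteq> D C b"
    and R_mono: "a \<sqsubseteq> b \<Longrightarrow> R C a \<sqsubseteq> R C b"
    and prd_mono: "\<lbrakk>a \<sqsubseteq> b; c \<sqsubseteq> d; a \<odot> c = Some x; b \<odot> d = Some y\<rbrakk> \<Longrightarrow> x \<sqsubseteq> y"

locale ehresmann_ordered_category = omega_structured_category C
  for C :: "('a, 'm) ordered_cat_scheme" (structure) +
  assumes OC6_D: "\<lbrakk>x \<in> carrier C; e \<in> identities C; e \<sqsubseteq> D C x\<rbrakk>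
          \<Longrightarrow> (\<exists>m. is_greatest (cle C) (below_D C e x) m) \<and> D C (restrict_D C e x) = e"
    and OC6_R: "\<lbrakk>x \<in> carrier C; e \<in> identities C; e \<sqsubseteq> R C x\<rbrakk>
          \<Longrightarrow> (\<exists>m. is_greatest (cle C) (below_R C x e) m) \<and> R C (restrict_R C x e) = e"
    and OC7': "\<lbrakk>b \<odot> c = Some d; a \<sqsubseteq> d\<rbrakk>
          \<Longrightarrow> \<exists>b' c' d'. b' \<sqsubseteq> b \<and> c' \<sqsubseteq> c \<and> D C a = D C b' \<and> R C a = R C c' \<and>
                b' \<odot> c' = Some d' \<and> a \<sqsubseteq> d'"
    and OCI: "\<lbrakk>a \<in> carrier C; e \<in> identities C; a \<sqsubseteq> e\<rbrakk> \<Longrightarrow> a \<in> identities C"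
    and meet_semilattice: "\<lbrakk>e \<in> identities C; f \<in> identities C\<rbrakk>
          \<Longrightarrow> \<exists>m. is_greatest (cle C) (lower_identities C e f) m"

definition ehresmann_ordered_morphism ::
    "('a, 'm) ordered_cat_scheme \<Rightarrow> ('b, 'n) ordered_cat_scheme \<Rightarrow> ('a \<Rightarrow> 'b) \<Rightarrow> bool" where
  "ehresmann_ordered_morphism C1 C2 F \<longleftrightarrow>
     category_functor C1 C2 F \<and>
     (\<forall>s t. s \<sqsubseteq>\<^bsub>C1\<^esub> t \<longrightarrow> F s \<sqsubseteq>\<^bsub>C2\<^esub> F t) \<and>
     (\<forall>e\<in>identities C1. \<forall>f\<in>identities C1. F (meet C1 e f) = meet C2 (F e) (F f)) \<and>
     (\<forall>s\<in>carrier C1. \<forall>e\<in>identities C1. e \<sqsubseteq>\<^bsub>C1\<^esub> D C1 s \<longrightarrow>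
        F (restrict_D C1 e s) = restrict_D C2 (F e) (F s)) \<and>
     (\<forall>s\<in>carrier C1. \<forall>f\<in>identities C1. f \<sqsubseteq>\<^bsub>C1\<^esub> R C1 s \<longrightarrow>
        F (restrict_R C1 s f) = restrict_R C2 (F s) (F f))"


section \<open>The two constructions\<close>

definition to_category :: "'a ordered_semigroup \<Rightarrow> 'a ordered_cat" where
  "to_category S =
     \<lparr>carrier = carrier S, D = D S, R = R S,
      prd = (\<lambda>s t. if s \<in> carrier S \<and> t \<in> carrier S \<and> R S s = D S t
                   then Some (s \<cdot>\<^bsub>S\<^esub> t) else None),
      cle = sle S\<rparr>"

definition pseudoproduct :: "('a, 'm) ordered_cat_scheme \<Rightarrow> 'a \<Rightarrow> 'a \<Rightarrow> 'a" where
  "pseudoproduct C s t =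
     (let e = meet C (R C s) (D C t) in the (restrict_R C s e \<odot>\<^bsub>C\<^esub> restrict_D C e t))"

definition to_semigroup :: "'a ordered_cat \<Rightarrow> 'a ordered_semigroup" where
  "to_semigroup C =
     \<lparr>carrier = carrier C, D = D C, R = R C,
      mult = (\<lambda>s\<in>carrier C. \<lambda>t\<in>carrier C. pseudoproduct C s t),
      sle = cle C\<rparr>"


section \<open>Categories of structures\<close>

text \<open>
  The arrows of a category of structures are the triples \<open>(S, F, T)\<close> with \<open>F\<close> a homomorphism from
  \<open>S\<close> to \<open>T\<close>; extensionality of \<open>F\<close> makes equality of arrows the equality of maps on the carrier.
  The identity arrow at \<open>S\<close> represents the object \<open>S\<close>.
\<close>

type_synonym ('a, 'm) structure_arrow =
  "('a, 'm) biunary_scheme \<times> ('a \<Rightarrow> 'a) \<times> ('a, 'm) biunary_scheme"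

definition identity_arrow :: "('a, 'm) biunary_scheme \<Rightarrow> ('a, 'm) structure_arrow" where
  "identity_arrow S = (S, (\<lambda>x\<in>carrier S. x), S)"

definition arrows ::
    "(('a, 'm) biunary_scheme \<Rightarrow> bool) \<Rightarrow>
     (('a, 'm) biunary_scheme \<Rightarrow> ('a, 'm) biunary_scheme \<Rightarrow> ('a \<Rightarrow> 'a) \<Rightarrow> bool) \<Rightarrow>
     ('a, 'm) structure_arrow set" where
  "arrows ob hm = {(S, F, T). ob S \<and> ob T \<and> F \<in> extensional (carrier S) \<and> hm S T F}"

definition structure_category ::
    "(('a, 'm) biunary_scheme \<Rightarrow> bool) \<Rightarrow>
     (('a, 'm) biunary_scheme \<Rightarrow> ('a, 'm) biunary_scheme \<Rightarrow> ('a \<Rightarrow> 'a) \<Rightarrow> bool) \<Rightarrow>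
     ('a, 'm) structure_arrow cat" where
  "structure_category ob hm =
     \<lparr>carrier = arrows ob hm,
      D = (\<lambda>(S, F, T) \<in> arrows ob hm. identity_arrow S),
      R = (\<lambda>(S, F, T) \<in> arrows ob hm. identity_arrow T),
      prd = (\<lambda>(S, F, T) (T', G, U).
               if (S, F, T) \<in> arrows ob hm \<and> (T', G, U) \<in> arrows ob hm \<and> T = T'
               then Some (S, compose (carrier S) G F, U) else None)\<rparr>"

definition ordered_ehresmann_semigroups where
  "ordered_ehresmann_semigroups =
     structure_category (ordered_ehresmann_semigroup :: 'a ordered_semigroup \<Rightarrow> bool)
       ordered_ehresmann_hom"

definition ehresmann_ordered_categories where
  "ehresmann_ordered_categories =
     structure_category (ehresmann_ordered_category :: 'a ordered_cat \<Rightarrow> bool)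
       ehresmann_ordered_morphism"

end

theory Submission
  imports Defs
begin

text \<open>
  The order determines what the semigroup product adds to the category product, and conversely.

  In an ordered Ehresmann semigroup the identities commute and are idempotent, and multiplying by
  an identity goes down in the order.  By monotonicity, the product of two identities is therefore
  their meet (\<open>mult_is_meet\<close>), and the products \<open>ex\<close> and \<open>xe\<close> are the restrictions \<open>e|x\<close> and \<open>x|e\<close>
  (\<open>restriction_left\<close>, \<open>restriction_right\<close>).  So the axioms of an Ehresmann-ordered category
  become statements about products; the only one that needs a construction is the splitting of an
  element below a product (\<open>factor_below_product\<close>).  The pseudoproduct then reads
  \<open>(s R(s) D(t)) (R(s) D(t) t)\<close>, which collapses to \<open>st\<close> (\<open>mult_via_meet\<close>).

  In an Ehresmann-ordered category the pseudoproduct \<open>s \<otimes> t\<close> is the greatest of the existing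
  products \<open>x \<circ> y\<close> with \<open>x \<le> s\<close> and \<open>y \<le> t\<close> (\<open>pseudoproduct_factors\<close>,
  \<open>prd_below_pseudoproduct\<close>).  Monotonicity is immediate from this description.  For associativity,
  axiom (OC7') replaces a factor below \<open>s \<otimes> t\<close> by an existing product of elements below \<open>s\<close> and
  \<open>t\<close>; hence both bracketings are the greatest of the triple products \<open>x \<circ> y \<circ> z\<close> with \<open>x \<le> s\<close>,
  \<open>y \<le> t\<close>, \<open>z \<le> u\<close>, and antisymmetry identifies them.  When \<open>s \<circ> t\<close> exists, it is itself this
  greatest element, so the category product is recovered from the pseudoproduct.

  A semigroup homomorphism preserves meets and restrictions because these are products; a morphism
  of Ehresmann-ordered categories preserves the pseudoproduct because it is built from meets,
  restrictions and an existing product.  Both constructions keep the carrier and leave the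
  underlying map of an arrow unchanged, so they are mutually inverse functors as soon as they are
  mutually inverse on objects.
\<close>

section \<open>Greatest elements\<close>

lemma greatest_eqI:
  assumes "\<And>x y. le x y \<Longrightarrow> le y x \<Longrightarrow> x = y" "is_greatest le A m"
  shows "greatest le A = m"
  unfolding greatest_def
proof (rule the_equality)
  show "is_greatest le A m" by fact
  show "n = m" if "is_greatest le A n" for n
    using assms that unfolding is_greatest_def by blast
qed

section \<open>From ordered Ehresmann semigroups to Ehresmann-ordered categories\<close>

context ordered_ehresmann_semigroup
begin

lemma D_in: "x \<in> carrier S \<Longrightarrow> D S x \<in> carrier S"
  and R_in: "x \<in> carrier S \<Longrightarrow> R S x \<in> carrier S"
  using D_closed R_closed by auto

lemma mult_in: "x \<in> carrier S \<Longrightarrow> y \<in> carrier S \<Longrightarrow> x \<cdot> y \<in> carrier S"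
  using mult_closed by (auto simp: PiE_iff)

lemma sle_refl: "x \<in> carrier S \<Longrightarrow> x \<preceq> x"
  and sle_antisym: "x \<preceq> y \<Longrightarrow> y \<preceq> x \<Longrightarrow> x = y"
  and sle_trans: "x \<preceq> y \<Longrightarrow> y \<preceq> z \<Longrightarrow> x \<preceq> z"
  and sle_in_left: "x \<preceq> y \<Longrightarrow> x \<in> carrier S"
  and sle_in_right: "x \<preceq> y \<Longrightarrow> y \<in> carrier S"
  using partial_order_onD[OF order]
  by (auto simp: refl_on_def dest: antisymD transD)

lemma D_D: "x \<in> carrier S \<Longrightarrow> D S (D S x) = D S x"
  by (metis D_R R_D D_in)

lemma identities_iff: "e \<in> identities S \<longleftrightarrow> e \<in> carrier S \<and> D S e = e"
  unfolding identities_def using D_in D_D by force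

lemma D_identity: "x \<in> carrier S \<Longrightarrow> D S x \<in> identities S"
  and R_identity: "x \<in> carrier S \<Longrightarrow> R S x \<in> identities S"
  by (simp_all add: identities_iff D_in R_in D_D D_R)

lemma identity_in: "e \<in> identities S \<Longrightarrow> e \<in> carrier S"
  and D_of_identity: "e \<in> identities S \<Longrightarrow> D S e = e"
  by (simp_all add: identities_iff)

lemma R_of_identity: "e \<in> identities S \<Longrightarrow> R S e = e"
  by (metis D_of_identity R_D identity_in)

lemma identity_idem: "e \<in> identities S \<Longrightarrow> e \<cdot> e = e"
  by (metis D_left D_of_identity identity_in)

lemma identity_mult: "\<lbrakk>e \<in> identities S; f \<in> identities S\<rbrakk> \<Longrightarrow> e \<cdot> f \<in> identities S"
  by (metis D_D_mult identities_iff mult_in)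

lemma identity_commute: "\<lbrakk>e \<in> identities S; f \<in> identities S\<rbrakk> \<Longrightarrow> e \<cdot> f = f \<cdot> e"
  by (metis D_commute identities_iff)

text \<open>
  The order on the identities is the natural order of the semilattice that they form: if
  \<open>e \<le> f\<close> then \<open>e = ee \<le> ef \<le> e\<close>.
\<close>

lemma identity_below_mult:
  assumes "e \<in> identities S" "f \<in> identities S" "e \<preceq> f"
  shows "e \<cdot> f = e" "f \<cdot> e = e"
proof -
  have "e \<preceq> e \<cdot> f"
    using mult_mono[OF sle_refl assms(3)] assms identity_idem identity_in by metis
  then show "e \<cdot> f = e"
    using assms mult_identity_right identity_in sle_antisym by blast
  then show "f \<cdot> e = e"
    using assms identity_commute by metis
qed

lemma mult_is_meet:
  assumes "e \<in> identities S" "f \<in> identities S"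
  shows "is_greatest (sle S) {g \<in> identities S. g \<preceq> e \<and> g \<preceq> f} (e \<cdot> f)"
  unfolding is_greatest_def
  using assms mult_mono identity_idem
  by (force simp: identity_mult mult_identity_left mult_identity_right identity_in)

lemma D_identity_left:
  assumes "x \<in> carrier S" "e \<in> identities S"
  shows "D S (e \<cdot> x) = e \<cdot> D S x"
  using D_D_mult[of e x] D_mult[of e x] assms by (simp add: D_of_identity identity_in)

lemma R_identity_right:
  assumes "x \<in> carrier S" "e \<in> identities S"
  shows "R S (x \<cdot> e) = R S x \<cdot> e"
  using R_mult[of x e] assms identity_mult[of "R S x" e] by (simp add: R_of_identity identity_in R_identity)

text \<open>
  An element \<open>y \<le> x\<close> with \<open>D(y) \<le> e\<close> satisfies \<open>y = D(y) y \<le> ex\<close>, and \<open>D(ex) = e D(x) = e\<close>.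
\<close>

lemma restriction_left:
  assumes "x \<in> carrier S" "e \<in> identities S" "e \<preceq> D S x"
  shows "is_greatest (sle S) {y \<in> carrier S. y \<preceq> x \<and> D S y \<preceq> e} (e \<cdot> x)"
    and "D S (e \<cdot> x) = e"
proof -
  show D: "D S (e \<cdot> x) = e"
    using assms by (simp add: D_identity_left identity_below_mult D_identity)
  have "y \<preceq> e \<cdot> x" if "y \<preceq> x" "D S y \<preceq> e" for y
    using mult_mono[OF that(2,1)] D_left[of y] sle_in_left[OF that(1)] by simp
  then show "is_greatest (sle S) {y \<in> carrier S. y \<preceq> x \<and> D S y \<preceq> e} (e \<cdot> x)"
    using assms by (auto simp: is_greatest_def D mult_in identity_in mult_identity_left sle_refl)
qed

lemma restriction_right:
  assumes "x \<in> carrier S" "e \<in> identities S" "e \<preceq> R S x"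
  shows "is_greatest (sle S) {y \<in> carrier S. y \<preceq> x \<and> R S y \<preceq> e} (x \<cdot> e)"
    and "R S (x \<cdot> e) = e"
proof -
  show R: "R S (x \<cdot> e) = e"
    using assms by (simp add: R_identity_right identity_below_mult R_identity)
  have "y \<preceq> x \<cdot> e" if "y \<preceq> x" "R S y \<preceq> e" for y
    using mult_mono[OF that] R_right[of y] sle_in_left[OF that(1)] by simp
  then show "is_greatest (sle S) {y \<in> carrier S. y \<preceq> x \<and> R S y \<preceq> e} (x \<cdot> e)"
    using assms by (auto simp: is_greatest_def R mult_in identity_in mult_identity_right sle_refl)
qed

lemma D_mult_below: "\<lbrakk>s \<in> carrier S; t \<in> carrier S\<rbrakk> \<Longrightarrow> D S (s \<cdot> t) \<preceq> D S s"
  using D_mult D_mono mult_identity_right D_identity by metis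

lemma R_mult_below: "\<lbrakk>s \<in> carrier S; t \<in> carrier S\<rbrakk> \<Longrightarrow> R S (s \<cdot> t) \<preceq> R S t"
  using R_mult R_mono mult_identity_left R_identity by metis

lemma D_composable: "\<lbrakk>s \<in> carrier S; t \<in> carrier S; R S s = D S t\<rbrakk> \<Longrightarrow> D S (s \<cdot> t) = D S s"
  by (metis D_mult R_right)

lemma R_composable: "\<lbrakk>s \<in> carrier S; t \<in> carrier S; R S s = D S t\<rbrakk> \<Longrightarrow> R S (s \<cdot> t) = R S t"
  by (metis R_mult D_left)

text \<open>
  This is the reason why the pseudoproduct of the associated category is the given product: the
  two middle identities are absorbed into \<open>s\<close> and \<open>t\<close> once they are commuted.
\<close>

lemma mult_via_meet:
  assumes "s \<in> carrier S" "t \<in> carrier S"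
  shows "(s \<cdot> (R S s \<cdot> D S t)) \<cdot> ((R S s \<cdot> D S t) \<cdot> t) = s \<cdot> t"
proof -
  let ?e = "R S s \<cdot> D S t"
  have e: "?e \<in> identities S"
    using assms identity_mult D_identity R_identity by blast
  have "s \<cdot> ?e = s \<cdot> D S t"
    using assms by (metis mult_assoc R_right R_in D_in)
  moreover have "?e \<cdot> t = R S s \<cdot> t"
    using assms by (metis mult_assoc D_left R_in D_in)
  ultimately have "(s \<cdot> ?e) \<cdot> (?e \<cdot> t) = (s \<cdot> D S t) \<cdot> (R S s \<cdot> t)" by simp
  also have "\<dots> = s \<cdot> ((D S t \<cdot> R S s) \<cdot> t)"
    using assms by (simp add: mult_assoc R_in D_in mult_in)
  also have "\<dots> = s \<cdot> ((R S s \<cdot> D S t) \<cdot> t)"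
    using assms identity_commute D_identity R_identity by metis
  also have "\<dots> = (s \<cdot> R S s) \<cdot> (D S t \<cdot> t)"
    using assms by (simp add: mult_assoc R_in D_in mult_in)
  finally show ?thesis
    using assms by (simp add: R_right D_left)
qed

text \<open>
  The splitting axiom (OC7').  Cutting \<open>b\<close> and \<open>c\<close> down to the required outer identities gives
  \<open>p = D(a) b\<close> and \<open>q = c R(a)\<close> with \<open>a = D(a) a R(a) \<le> pq\<close>, but \<open>p\<close> and \<open>q\<close> need not be
  composable.  Restricting both to the meet \<open>e\<close> of \<open>R(p)\<close> and \<open>D(q)\<close> makes them so without changing
  their product.
\<close>

lemma factor_below_product:
  assumes b: "b \<in> carrier S" and c: "c \<in> carrier S" and bc: "R S b = D S c" and a: "a \<preceq> b \<cdot> c"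
  obtains b' c' where "b' \<preceq> b" "c' \<preceq> c" "D S a = D S b'" "R S a = R S c'"
    "R S b' = D S c'" "a \<preceq> b' \<cdot> c'"
proof -
  define p where "p = D S a \<cdot> b"
  define q where "q = c \<cdot> R S a"
  define e where "e = R S p \<cdot> D S q"
  note a_in = sle_in_left[OF a]
  note [simp] = a_in b c D_in R_in mult_in
  have p: "p \<in> carrier S" and q: "q \<in> carrier S" by (simp_all add: p_def q_def)
  have e: "e \<in> identities S"
    using p q identity_mult D_identity R_identity by (simp add: e_def)
  have D_a: "D S a \<preceq> D S b" and R_a: "R S a \<preceq> R S c"
    using D_mono[OF a] R_mono[OF a] D_composable R_composable b c bc by simp_all
  have D_p: "D S p = D S a" and R_q: "R S q = R S a"
    using restriction_left(2)[of b "D S a"] restriction_right(2)[of c "R S a"] D_a R_a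
    by (simp_all add: p_def q_def D_identity R_identity)
  have prod: "(p \<cdot> e) \<cdot> (e \<cdot> q) = p \<cdot> q"
    using mult_via_meet[OF p q] by (simp add: e_def)
  have "D S a \<cdot> a \<cdot> R S a \<preceq> D S a \<cdot> (b \<cdot> c) \<cdot> R S a"
    by (intro mult_mono a sle_refl) simp_all
  then have below: "a \<preceq> (p \<cdot> e) \<cdot> (e \<cdot> q)"
    unfolding prod by (simp add: D_left R_right p_def q_def mult_assoc)
  have pe: "p \<cdot> e \<preceq> p" and eq: "e \<cdot> q \<preceq> q"
    using mult_identity_left mult_identity_right p q e by blast+
  note pe_in = sle_in_left[OF pe] and eq_in = sle_in_left[OF eq]
  show ?thesis
  proof
    show "p \<cdot> e \<preceq> b"
      using sle_trans[OF pe] mult_identity_left[of b "D S a"] by (simp add: p_def D_identity)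
    show "e \<cdot> q \<preceq> c"
      using sle_trans[OF eq] mult_identity_right[of c "R S a"] by (simp add: q_def R_identity)
    (* Restricting p to e could shrink its domain; the bound a \<preceq> (p e)(e q) prevents this. *)
    show "D S a = D S (p \<cdot> e)"
      using D_mono[OF below] D_mult_below[OF pe_in eq_in] D_mono[OF pe] D_p
      by (metis sle_antisym sle_trans)
    show "R S a = R S (e \<cdot> q)"
      using R_mono[OF below] R_mult_below[OF pe_in eq_in] R_mono[OF eq] R_q
      by (metis sle_antisym sle_trans)
    have "R S p \<cdot> e = (R S p \<cdot> R S p) \<cdot> D S q" "e \<cdot> D S q = R S p \<cdot> (D S q \<cdot> D S q)"
      using p q by (simp_all add: e_def mult_assoc)
    then have "R S p \<cdot> e = e" "e \<cdot> D S q = e"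
      using p q by (simp_all add: identity_idem D_identity R_identity e_def)
    then show "R S (p \<cdot> e) = D S (e \<cdot> q)"
      using p q e by (simp add: R_identity_right D_identity_left)
    show "a \<preceq> (p \<cdot> e) \<cdot> (e \<cdot> q)" by fact
  qed
qed

end

lemma to_category_simps [simp]:
  "carrier (to_category S) = carrier S" "D (to_category S) = D S" "R (to_category S) = R S"
  "cle (to_category S) = sle S" "identities (to_category S) = identities S"
  "prd (to_category S) s t = (if s \<in> carrier S \<and> t \<in> carrier S \<and> R S s = D S t
                   then Some (s \<cdot>\<^bsub>S\<^esub> t) else None)"
  by (simp_all add: to_category_def identities_def)

context
  fixes S :: "'a ordered_semigroup" (structure)
  assumes S: "ordered_ehresmann_semigroup S"
begin

interpretation ordered_ehresmann_semigroup S by (fact S)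

lemma meet_to_category:
  assumes "e \<in> identities S" "f \<in> identities S"
  shows "is_greatest (sle S) (lower_identities (to_category S) e f) (e \<cdot> f)"
    and "meet (to_category S) e f = e \<cdot> f"
proof -
  show *: "is_greatest (sle S) (lower_identities (to_category S) e f) (e \<cdot> f)"
    using mult_is_meet[OF assms] by (simp add: lower_identities_def)
  show "meet (to_category S) e f = e \<cdot> f"
    using greatest_eqI[of "sle S", OF sle_antisym *] by (simp add: meet_def)
qed

lemma restrict_D_to_category:
  assumes "x \<in> carrier S" "e \<in> identities S" "e \<preceq> D S x"
  shows "is_greatest (sle S) (below_D (to_category S) e x) (e \<cdot> x)"
    and "restrict_D (to_category S) e x = e \<cdot> x"
proof -
  show *: "is_greatest (sle S) (below_D (to_category S) e x) (e \<cdot> x)"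
    using restriction_left(1)[OF assms] by (simp add: below_D_def)
  show "restrict_D (to_category S) e x = e \<cdot> x"
    using greatest_eqI[of "sle S", OF sle_antisym *] by (simp add: restrict_D_def)
qed

lemma restrict_R_to_category:
  assumes "x \<in> carrier S" "e \<in> identities S" "e \<preceq> R S x"
  shows "is_greatest (sle S) (below_R (to_category S) x e) (x \<cdot> e)"
    and "restrict_R (to_category S) x e = x \<cdot> e"
proof -
  show *: "is_greatest (sle S) (below_R (to_category S) x e) (x \<cdot> e)"
    using restriction_right(1)[OF assms] by (simp add: below_R_def)
  show "restrict_R (to_category S) x e = x \<cdot> e"
    using greatest_eqI[of "sle S", OF sle_antisym *] by (simp add: restrict_R_def)
qed

lemma ehresmann_ordered_category_to_category: "ehresmann_ordered_category (to_category S)"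
proof (unfold_locales, goal_cases)
  case 1 then show ?case using D_closed by simp
next
  case 2 then show ?case using R_closed by simp
next
  case (3 x y z) then show ?case by (auto simp: mult_in split: if_splits)
next
  case (4 x y) then show ?case by simp
next
  case (5 x) then show ?case by (simp add: D_in R_D D_left)
next
  case (6 x) then show ?case by (simp add: R_in D_R R_right)
next
  case (7 x) then show ?case by (simp add: D_R)
next
  case (8 x) then show ?case by (simp add: R_D)
next
  case (9 x y z) then show ?case by (auto simp: D_composable split: if_splits)
next
  case (10 x y z) then show ?case by (auto simp: R_composable split: if_splits)
next
  case (11 x y xy z u yz v) then show ?case by (auto simp: mult_assoc split: if_splits)
next
  case 12 then show ?case using order by simp
next
  case (13 a b) then show ?case by (simp add: D_mono)
next
  case (14 a b) then show ?case by (simp add: R_mono)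
next
  case (15 a b c d x y) then show ?case by (auto simp: mult_mono split: if_splits)
next
  case (16 x e) then show ?case
    using restrict_D_to_category[of x e] restriction_left(2)[of x e] by auto
next
  case (17 x e) then show ?case
    using restrict_R_to_category[of x e] restriction_right(2)[of x e] by auto
next
  case (18 b c d a)
  then have "b \<in> carrier S" "c \<in> carrier S" "R S b = D S c" "a \<preceq> b \<cdot> c"
    by (auto split: if_splits)
  then obtain b' c' where "b' \<preceq> b" "c' \<preceq> c" "D S a = D S b'" "R S a = R S c'"
    "R S b' = D S c'" "a \<preceq> b' \<cdot> c'"
    by (rule factor_below_product)
  then show ?case
    by (intro exI[of _ b'] exI[of _ c'] exI[of _ "b' \<cdot> c'"]) (simp add: sle_in_left)
next
  case (19 a e) then show ?case by (simp add: below_identity)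
next
  case (20 e f) then show ?case using meet_to_category by auto
qed

text \<open>
  For \<open>e = R(s) D(t)\<close> the restrictions \<open>s|e\<close> and \<open>e|t\<close> are \<open>se\<close> and \<open>et\<close>, and they are composable
  because the range of the first and the domain of the second are both \<open>e\<close>.
\<close>

lemma pseudoproduct_to_category:
  assumes s: "s \<in> carrier S" and t: "t \<in> carrier S"
  shows "pseudoproduct (to_category S) s t = s \<cdot> t"
proof -
  let ?e = "R S s \<cdot> D S t"
  have e: "?e \<in> identities S" "?e \<preceq> R S s" "?e \<preceq> D S t"
    using s t by (simp_all add: identity_mult mult_identity_left mult_identity_right
        D_identity R_identity D_in R_in)
  then show ?thesis
    using s t restriction_left(2)[OF t e(1,3)] restriction_right(2)[OF s e(1,2)]
    by (simp add: pseudoproduct_def Let_def meet_to_category restrict_D_to_category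
        restrict_R_to_category D_identity R_identity mult_in identity_in mult_via_meet)
qed

lemma to_semigroup_to_category: "to_semigroup (to_category S) = S"
proof -
  have "(\<lambda>s\<in>carrier S. \<lambda>t\<in>carrier S. pseudoproduct (to_category S) s t)
      = (\<lambda>s\<in>carrier S. \<lambda>t\<in>carrier S. s \<cdot> t)"
    by (intro restrict_ext) (simp add: pseudoproduct_to_category)
  also have "\<dots> = mult S"
  proof (intro ext)
    \<comment> \<open>Off the carrier both sides are \<^const>\<open>undefined\<close>.\<close>
    show "(\<lambda>s\<in>carrier S. \<lambda>t\<in>carrier S. s \<cdot> t) s t = s \<cdot> t" for s t
      using mult_closed by (auto simp: restrict_def PiE_iff extensional_def)
  qed
  finally show ?thesis
    by (simp add: to_semigroup_def)
qed

end

section \<open>From Ehresmann-ordered categories to ordered Ehresmann semigroups\<close>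

context ehresmann_ordered_category
begin

lemma D_in: "x \<in> carrier C \<Longrightarrow> D C x \<in> carrier C"
  and R_in: "x \<in> carrier C \<Longrightarrow> R C x \<in> carrier C"
  using D_closed R_closed by auto

lemma cle_refl: "x \<in> carrier C \<Longrightarrow> x \<sqsubseteq> x"
  and cle_antisym: "x \<sqsubseteq> y \<Longrightarrow> y \<sqsubseteq> x \<Longrightarrow> x = y"
  and cle_trans: "x \<sqsubseteq> y \<Longrightarrow> y \<sqsubseteq> z \<Longrightarrow> x \<sqsubseteq> z"
  and cle_in_left: "x \<sqsubseteq> y \<Longrightarrow> x \<in> carrier C"
  and cle_in_right: "x \<sqsubseteq> y \<Longrightarrow> y \<in> carrier C"
  using partial_order_onD[OF order]
  by (auto simp: refl_on_def dest: antisymD transD)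

lemma D_D: "x \<in> carrier C \<Longrightarrow> D C (D C x) = D C x"
  by (metis D_R R_D D_in)

lemma identities_iff: "e \<in> identities C \<longleftrightarrow> e \<in> carrier C \<and> D C e = e"
  unfolding identities_def using D_in D_D by force

lemma D_identity: "x \<in> carrier C \<Longrightarrow> D C x \<in> identities C"
  and R_identity: "x \<in> carrier C \<Longrightarrow> R C x \<in> identities C"
  by (simp_all add: identities_iff D_in R_in D_D D_R)

lemma identity_in: "e \<in> identities C \<Longrightarrow> e \<in> carrier C"
  and D_of_identity: "e \<in> identities C \<Longrightarrow> D C e = e"
  by (simp_all add: identities_iff)

lemma R_of_identity: "e \<in> identities C \<Longrightarrow> R C e = e"
  by (metis D_of_identity R_D identity_in)

lemma prd_exists:
  assumes "x \<in> carrier C" "y \<in> carrier C" "R C x = D C y"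
  obtains z where "x \<odot> y = Some z"
  using assms prd_defined by blast

lemma prd_SomeD:
  assumes "x \<odot> y = Some z"
  shows "x \<in> carrier C" "y \<in> carrier C" "R C x = D C y"
  using assms prd_defined by (metis option.distinct(1))+

lemma restrict_D_greatest:
  assumes "x \<in> carrier C" "e \<in> identities C" "e \<sqsubseteq> D C x"
  shows "is_greatest (cle C) (below_D C e x) (restrict_D C e x)"
  using OC6_D[OF assms] greatest_eqI[of "cle C", OF cle_antisym]
  by (metis restrict_D_def)

lemma restrict_R_greatest:
  assumes "x \<in> carrier C" "e \<in> identities C" "e \<sqsubseteq> R C x"
  shows "is_greatest (cle C) (below_R C x e) (restrict_R C x e)"
  using OC6_R[OF assms] greatest_eqI[of "cle C", OF cle_antisym]
  by (metis restrict_R_def)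

lemma restrict_D:
  assumes "x \<in> carrier C" "e \<in> identities C" "e \<sqsubseteq> D C x"
  shows "restrict_D C e x \<sqsubseteq> x" "D C (restrict_D C e x) = e"
    "\<And>y. \<lbrakk>y \<sqsubseteq> x; D C y \<sqsubseteq> e\<rbrakk> \<Longrightarrow> y \<sqsubseteq> restrict_D C e x"
  using restrict_D_greatest[OF assms] OC6_D[OF assms] cle_in_left
  by (auto simp: is_greatest_def below_D_def)

lemma restrict_R:
  assumes "x \<in> carrier C" "e \<in> identities C" "e \<sqsubseteq> R C x"
  shows "restrict_R C x e \<sqsubseteq> x" "R C (restrict_R C x e) = e"
    "\<And>y. \<lbrakk>y \<sqsubseteq> x; R C y \<sqsubseteq> e\<rbrakk> \<Longrightarrow> y \<sqsubseteq> restrict_R C x e"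
  using restrict_R_greatest[OF assms] OC6_R[OF assms] cle_in_left
  by (auto simp: is_greatest_def below_R_def)

lemma restrict_D_trivial: "x \<in> carrier C \<Longrightarrow> restrict_D C (D C x) x = x"
  using restrict_D[of x "D C x"] by (simp add: D_identity cle_refl cle_antisym D_in)

lemma restrict_R_trivial: "x \<in> carrier C \<Longrightarrow> restrict_R C x (R C x) = x"
  using restrict_R[of x "R C x"] by (simp add: R_identity cle_refl cle_antisym R_in)

text \<open>
  By (OCI) the restriction of an identity is an identity, hence equal to its own domain and range.
\<close>

lemma restrict_D_identity:
  assumes "e \<in> identities C" "f \<in> identities C" "e \<sqsubseteq> f"
  shows "restrict_D C e f = e"
  using restrict_D[of f e] OCI[of "restrict_D C e f" f] assms cle_in_left
  by (metis D_of_identity identity_in)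

lemma restrict_R_identity:
  assumes "e \<in> identities C" "f \<in> identities C" "e \<sqsubseteq> f"
  shows "restrict_R C f e = e"
  using restrict_R[of f e] OCI[of "restrict_R C f e" f] assms cle_in_left
  by (metis R_of_identity identity_in)

lemma meet:
  assumes "e \<in> identities C" "f \<in> identities C"
  shows "meet C e f \<in> identities C" "meet C e f \<sqsubseteq> e" "meet C e f \<sqsubseteq> f"
    "\<And>g. \<lbrakk>g \<in> identities C; g \<sqsubseteq> e; g \<sqsubseteq> f\<rbrakk> \<Longrightarrow> g \<sqsubseteq> meet C e f"
proof -
  have "is_greatest (cle C) (lower_identities C e f) (meet C e f)"
    using meet_semilattice[OF assms] greatest_eqI[of "cle C", OF cle_antisym]
    by (metis meet_def)
  then show "meet C e f \<in> identities C" "meet C e f \<sqsubseteq> e" "meet C e f \<sqsubseteq> f"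
    "\<And>g. \<lbrakk>g \<in> identities C; g \<sqsubseteq> e; g \<sqsubseteq> f\<rbrakk> \<Longrightarrow> g \<sqsubseteq> meet C e f"
    by (auto simp: is_greatest_def lower_identities_def)
qed

lemma meet_commute: "meet C e f = meet C f e"
  by (simp add: meet_def lower_identities_def conj_commute)

lemma meet_idem: "e \<in> identities C \<Longrightarrow> meet C e e = e"
  by (metis meet cle_refl cle_antisym identity_in)

lemma pseudoproduct_Some:
  assumes "s \<in> carrier C" "t \<in> carrier C" and e: "e = meet C (R C s) (D C t)"
  shows "restrict_R C s e \<odot> restrict_D C e t = Some (pseudoproduct C s t)"
proof -
  have e': "e \<in> identities C" "e \<sqsubseteq> R C s" "e \<sqsubseteq> D C t"
    using assms meet D_identity R_identity by auto
  have "restrict_R C s e \<in> carrier C" "restrict_D C e t \<in> carrier C"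
    using restrict_R(1)[of s e] restrict_D(1)[of t e] assms e' cle_in_left by blast+
  then obtain z where "restrict_R C s e \<odot> restrict_D C e t = Some z"
    using prd_exists restrict_R(2)[of s e] restrict_D(2)[of t e] assms e' by metis
  then show ?thesis
    by (simp add: pseudoproduct_def Let_def flip: e)
qed

lemma pseudoproduct_in: "\<lbrakk>s \<in> carrier C; t \<in> carrier C\<rbrakk> \<Longrightarrow> pseudoproduct C s t \<in> carrier C"
  using pseudoproduct_Some prd_closed by blast

text \<open>
  Together with the lemma that follows it, this characterises \<open>s \<otimes> t\<close> as the greatest existing
  product of an element below \<open>s\<close> and an element below \<open>t\<close>.
\<close>

lemma pseudoproduct_factors:
  assumes "s \<in> carrier C" "t \<in> carrier C"
  obtains x y where "x \<sqsubseteq> s" "y \<sqsubseteq> t" "x \<odot> y = Some (pseudoproduct C s t)"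
proof
  show "restrict_R C s (meet C (R C s) (D C t)) \<sqsubseteq> s" "restrict_D C (meet C (R C s) (D C t)) t \<sqsubseteq> t"
    using assms by (simp_all add: restrict_R(1) restrict_D(1) meet D_identity R_identity)
qed (rule pseudoproduct_Some[OF assms refl])

text \<open>
  If \<open>x \<circ> y\<close> exists then \<open>R(x) = D(y)\<close> is a common lower bound of \<open>R(s)\<close> and \<open>D(t)\<close>, hence lies below
  their meet \<open>e\<close>; so \<open>x \<le> s|e\<close> and \<open>y \<le> e|t\<close>.
\<close>

lemma prd_below_pseudoproduct:
  assumes "x \<sqsubseteq> s" "y \<sqsubseteq> t" and z: "x \<odot> y = Some z"
  shows "z \<sqsubseteq> pseudoproduct C s t"
proof -
  have in_C: "s \<in> carrier C" "t \<in> carrier C"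
    using assms cle_in_right by blast+
  define e where "e = meet C (R C s) (D C t)"
  have e: "e \<in> identities C" "e \<sqsubseteq> R C s" "e \<sqsubseteq> D C t"
    using in_C meet D_identity R_identity by (auto simp: e_def)
  have "R C x \<sqsubseteq> R C s" "R C x \<sqsubseteq> D C t" "R C x \<in> identities C"
    using R_mono[OF assms(1)] D_mono[OF assms(2)] R_identity prd_SomeD[OF z] by metis+
  then have "R C x \<sqsubseteq> e"
    using in_C by (simp add: e_def meet(4) D_identity R_identity)
  then have "R C x \<sqsubseteq> e" "D C y \<sqsubseteq> e"
    using prd_SomeD(3)[OF z] by simp_all
  then have "x \<sqsubseteq> restrict_R C s e" "y \<sqsubseteq> restrict_D C e t"
    using assms(1,2) in_C e by (simp_all add: restrict_R(3) restrict_D(3))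
  then show ?thesis
    using prd_mono z pseudoproduct_Some[OF in_C e_def] by blast
qed

lemma pseudoproduct_composable:
  assumes "x \<odot> y = Some z"
  shows "pseudoproduct C x y = z"
  using pseudoproduct_Some[OF prd_SomeD(1,2)[OF assms] refl] assms prd_SomeD[OF assms]
  by (simp add: meet_idem restrict_D_trivial restrict_R_trivial D_identity)
    (metis restrict_R_trivial option.inject)

lemma pseudoproduct_mono:
  assumes "a \<sqsubseteq> b" "c \<sqsubseteq> d"
  shows "pseudoproduct C a c \<sqsubseteq> pseudoproduct C b d"
proof -
  obtain x y where "x \<sqsubseteq> a" "y \<sqsubseteq> c" "x \<odot> y = Some (pseudoproduct C a c)"
    using pseudoproduct_factors assms cle_in_left by metis
  then show ?thesis
    using prd_below_pseudoproduct assms cle_trans by blast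
qed

text \<open>
  The domains and ranges of the two products of one bracketing force the products of the other
  bracketing to exist.
\<close>

lemma prd_assoc_left:
  assumes "x \<odot> y = Some xy" "xy \<odot> z = Some u"
  obtains yz where "y \<odot> z = Some yz" "x \<odot> yz = Some u"
proof -
  obtain yz where yz: "y \<odot> z = Some yz"
    using assms prd_SomeD R_prd prd_exists by metis
  moreover obtain v where v: "x \<odot> yz = Some v"
    using assms prd_SomeD D_prd prd_exists prd_closed yz by metis
  ultimately show ?thesis
    using that prd_assoc assms by blast
qed

lemma prd_assoc_right:
  assumes "y \<odot> z = Some yz" "x \<odot> yz = Some u"
  obtains xy where "x \<odot> y = Some xy" "xy \<odot> z = Some u"
proof -
  obtain xy where xy: "x \<odot> y = Some xy"
    using assms prd_SomeD D_prd prd_exists by metis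
  moreover obtain v where v: "xy \<odot> z = Some v"
    using assms prd_SomeD R_prd prd_exists prd_closed xy by metis
  ultimately show ?thesis
    using that prd_assoc assms by blast
qed

text \<open>
  Write the left side as \<open>z \<circ> w\<close> with \<open>z \<le> s \<otimes> t\<close> and \<open>w \<le> u\<close>.  By (OC7') there is an existing
  product \<open>x' \<circ> y' \<ge> z\<close> of elements below \<open>s\<close> and \<open>t\<close> with the same range as \<open>z\<close>, so that
  \<open>x' \<circ> (y' \<circ> w)\<close> exists and lies above \<open>z \<circ> w\<close>.
\<close>

lemma pseudoproduct_assoc_below:
  assumes in_C: "s \<in> carrier C" "t \<in> carrier C" "u \<in> carrier C"
  shows "pseudoproduct C (pseudoproduct C s t) u \<sqsubseteq> pseudoproduct C s (pseudoproduct C t u)"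
proof -
  obtain z w where z: "z \<sqsubseteq> pseudoproduct C s t" and w: "w \<sqsubseteq> u"
    and zw: "z \<odot> w = Some (pseudoproduct C (pseudoproduct C s t) u)"
    using pseudoproduct_factors in_C pseudoproduct_in by metis
  obtain x y where x: "x \<sqsubseteq> s" and y: "y \<sqsubseteq> t" and xy: "x \<odot> y = Some (pseudoproduct C s t)"
    using pseudoproduct_factors in_C by metis
  obtain x' y' z' where x': "x' \<sqsubseteq> x" and y': "y' \<sqsubseteq> y" and R: "R C z = R C y'"
    and z': "x' \<odot> y' = Some z'" and zz': "z \<sqsubseteq> z'"
    using OC7'[OF xy z] by blast
  obtain v where v: "z' \<odot> w = Some v"
    using prd_exists prd_closed[OF z'] prd_SomeD[OF zw] R R_prd[OF z'] by metis
  obtain yw where yw: "y' \<odot> w = Some yw" and xyw: "x' \<odot> yw = Some v"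
    using prd_assoc_left[OF z' v] .
  have "pseudoproduct C (pseudoproduct C s t) u \<sqsubseteq> v"
    using prd_mono[OF zz' cle_refl zw v] prd_SomeD[OF zw] by simp
  also have "v \<sqsubseteq> pseudoproduct C s (pseudoproduct C t u)"
    using prd_below_pseudoproduct xyw cle_trans[OF x' x]
      prd_below_pseudoproduct[OF cle_trans[OF y' y] w yw] by blast
  finally (cle_trans) show ?thesis .
qed

text \<open>
  The mirror image of the preceding argument; it uses the equality of domains in (OC7') where that
  one uses the equality of ranges.
\<close>

lemma pseudoproduct_assoc_above:
  assumes in_C: "s \<in> carrier C" "t \<in> carrier C" "u \<in> carrier C"
  shows "pseudoproduct C s (pseudoproduct C t u) \<sqsubseteq> pseudoproduct C (pseudoproduct C s t) u"
proof -
  obtain w z where w: "w \<sqsubseteq> s" and z: "z \<sqsubseteq> pseudoproduct C t u"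
    and wz: "w \<odot> z = Some (pseudoproduct C s (pseudoproduct C t u))"
    using pseudoproduct_factors in_C pseudoproduct_in by metis
  obtain x y where x: "x \<sqsubseteq> t" and y: "y \<sqsubseteq> u" and xy: "x \<odot> y = Some (pseudoproduct C t u)"
    using pseudoproduct_factors in_C by metis
  obtain x' y' z' where x': "x' \<sqsubseteq> x" and y': "y' \<sqsubseteq> y" and D: "D C z = D C x'"
    and z': "x' \<odot> y' = Some z'" and zz': "z \<sqsubseteq> z'"
    using OC7'[OF xy z] by blast
  obtain v where v: "w \<odot> z' = Some v"
    using prd_exists prd_closed[OF z'] prd_SomeD[OF wz] D D_prd[OF z'] by metis
  obtain wx where wx: "w \<odot> x' = Some wx" and wxy: "wx \<odot> y' = Some v"
    using prd_assoc_right[OF z' v] .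
  have "pseudoproduct C s (pseudoproduct C t u) \<sqsubseteq> v"
    using prd_mono[OF cle_refl zz' wz v] prd_SomeD[OF wz] by simp
  also have "v \<sqsubseteq> pseudoproduct C (pseudoproduct C s t) u"
    using prd_below_pseudoproduct wxy cle_trans[OF y' y]
      prd_below_pseudoproduct[OF w cle_trans[OF x' x] wx] by blast
  finally (cle_trans) show ?thesis .
qed

lemma pseudoproduct_assoc:
  assumes "s \<in> carrier C" "t \<in> carrier C" "u \<in> carrier C"
  shows "pseudoproduct C (pseudoproduct C s t) u = pseudoproduct C s (pseudoproduct C t u)"
  using assms pseudoproduct_assoc_below pseudoproduct_assoc_above cle_antisym by blast

text \<open>
  The right side depends on \<open>t\<close> only through \<open>D(t)\<close>, which gives \<open>D(s \<otimes> t) = D(s \<otimes> D(t))\<close>.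
\<close>

lemma D_pseudoproduct:
  assumes "s \<in> carrier C" "t \<in> carrier C"
  shows "D C (pseudoproduct C s t) = D C (restrict_R C s (meet C (R C s) (D C t)))"
  using D_prd[OF pseudoproduct_Some[OF assms refl]] .

lemma R_pseudoproduct:
  assumes "s \<in> carrier C" "t \<in> carrier C"
  shows "R C (pseudoproduct C s t) = R C (restrict_D C (meet C (R C s) (D C t)) t)"
  using R_prd[OF pseudoproduct_Some[OF assms refl]] .

text \<open>
  The second factor of \<open>s \<otimes> e\<close> is the restriction of an identity, so it is an identity and disappears
  from the category product.
\<close>

lemma pseudoproduct_identity_right:
  assumes "s \<in> carrier C" "e \<in> identities C"
  shows "pseudoproduct C s e = restrict_R C s (meet C (R C s) e)"
proof -
  let ?f = "meet C (R C s) e"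
  have f: "?f \<in> identities C" "?f \<sqsubseteq> R C s" "?f \<sqsubseteq> e"
    using assms by (simp_all add: meet R_identity)
  have "restrict_R C s ?f \<odot> ?f = Some (pseudoproduct C s e)"
    using pseudoproduct_Some[of s e ?f] assms f
    by (simp add: D_of_identity identity_in restrict_D_identity)
  then show ?thesis
    using R_prd_right[of "restrict_R C s ?f"] restrict_R(1,2)[of s ?f] cle_in_left assms f
    by (metis option.inject)
qed

lemma pseudoproduct_identity_left:
  assumes "s \<in> carrier C" "e \<in> identities C"
  shows "pseudoproduct C e s = restrict_D C (meet C e (D C s)) s"
proof -
  let ?f = "meet C e (D C s)"
  have f: "?f \<in> identities C" "?f \<sqsubseteq> D C s" "?f \<sqsubseteq> e"
    using assms by (simp_all add: meet D_identity)
  have "?f \<odot> restrict_D C ?f s = Some (pseudoproduct C e s)"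
    using pseudoproduct_Some[of e s ?f] assms f
    by (simp add: R_of_identity identity_in restrict_R_identity)
  then show ?thesis
    using D_prd_left[of "restrict_D C ?f s"] restrict_D(1,2)[of s ?f] cle_in_left assms f
    by (metis option.inject)
qed

lemma pseudoproduct_identities:
  assumes "e \<in> identities C" "f \<in> identities C"
  shows "pseudoproduct C e f = meet C e f"
  using assms meet
  by (simp add: pseudoproduct_identity_right identity_in R_of_identity restrict_R_identity)

end

lemma to_semigroup_simps [simp]:
  "carrier (to_semigroup C) = carrier C" "D (to_semigroup C) = D C" "R (to_semigroup C) = R C"
  "sle (to_semigroup C) = cle C" "identities (to_semigroup C) = identities C"
  "\<lbrakk>s \<in> carrier C; t \<in> carrier C\<rbrakk> \<Longrightarrow> mult (to_semigroup C) s t = pseudoproduct C s t"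
  by (simp_all add: to_semigroup_def identities_def)

context
  fixes C :: "'a ordered_cat" (structure)
  assumes C: "ehresmann_ordered_category C"
begin

interpretation ehresmann_ordered_category C by (fact C)

lemma ordered_ehresmann_semigroup_to_semigroup: "ordered_ehresmann_semigroup (to_semigroup C)"
proof (unfold_locales, goal_cases)
  case 1 then show ?case using D_closed by simp
next
  case 2 then show ?case using R_closed by simp
next
  case 3 then show ?case by (auto simp: to_semigroup_def pseudoproduct_in)
next
  case (4 s t u) then show ?case by (simp add: pseudoproduct_in pseudoproduct_assoc)
next
  case (5 s) then show ?case
    using pseudoproduct_composable[OF D_prd_left] by (simp add: D_in)
next
  case (6 s) then show ?case
    using pseudoproduct_composable[OF R_prd_right] by (simp add: R_in)
next
  case (7 s) then show ?case by (simp add: D_R)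
next
  case (8 s) then show ?case by (simp add: R_D)
next
  case (9 s t) then show ?case by (simp add: D_pseudoproduct D_in D_D)
next
  case (10 s t) then show ?case
    by (simp add: R_pseudoproduct R_in R_of_identity R_identity)
next
  case (11 s t) then show ?case
    by (simp add: D_in pseudoproduct_identities D_identity meet(1) D_of_identity)
next
  case (12 s t) then show ?case
    by (simp add: D_in pseudoproduct_identities D_identity meet_commute)
next
  case 13 then show ?case using order by simp
next
  case (14 a b) then show ?case by (simp add: D_mono)
next
  case (15 a b) then show ?case by (simp add: R_mono)
next
  case (16 a b c d) then show ?case
    using cle_in_left cle_in_right by (simp add: pseudoproduct_mono)
next
  case (17 a e) then show ?case
    by (simp add: identity_in pseudoproduct_identity_right restrict_R(1) meet R_identity)
next
  case (18 a e) then show ?case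
    by (simp add: identity_in pseudoproduct_identity_left restrict_D(1) meet D_identity)
next
  case (19 a e) then show ?case by (simp add: OCI)
qed

lemma to_category_to_semigroup: "to_category (to_semigroup C) = C"
proof -
  have "prd (to_category (to_semigroup C)) = prd C"
  proof (intro ext)
    show "prd (to_category (to_semigroup C)) s t = s \<odot> t" for s t
      using prd_defined[of s t] pseudoproduct_composable[of s t] by auto
  qed
  then show ?thesis by (simp add: to_category_def)
qed

end

section \<open>Homomorphisms and morphisms\<close>

lemma hom_imp_morphism:
  assumes S: "ordered_ehresmann_semigroup S" and T: "ordered_ehresmann_semigroup T"
    and F: "ordered_ehresmann_hom S T F"
  shows "ehresmann_ordered_morphism (to_category S) (to_category T) F"
proof -
  interpret S: ordered_ehresmann_semigroup S by fact
  interpret T: ordered_ehresmann_semigroup T by fact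
  interpret CS: ehresmann_ordered_category "to_category S"
    by (rule ehresmann_ordered_category_to_category[OF S])
  interpret CT: ehresmann_ordered_category "to_category T"
    by (rule ehresmann_ordered_category_to_category[OF T])
  have F_in: "F x \<in> carrier T" if "x \<in> carrier S" for x
    using F that by (auto simp: ordered_ehresmann_hom_def)
  have F_mult: "F (x \<cdot>\<^bsub>S\<^esub> y) = F x \<cdot>\<^bsub>T\<^esub> F y" if "x \<in> carrier S" "y \<in> carrier S" for x y
    using F that by (auto simp: ordered_ehresmann_hom_def)
  have F_D: "F (D S x) = D T (F x)" and F_R: "F (R S x) = R T (F x)" if "x \<in> carrier S" for x
    using F that by (auto simp: ordered_ehresmann_hom_def)
  have F_mono: "F x \<preceq>\<^bsub>T\<^esub> F y" if "x \<preceq>\<^bsub>S\<^esub> y" for x y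
    using F that by (auto simp: ordered_ehresmann_hom_def)
  have F_id: "F e \<in> identities T" if "e \<in> identities S" for e
    using that F_D[of e] F_in[of e] by (simp add: S.identities_iff T.identities_iff)
  show ?thesis
    unfolding ehresmann_ordered_morphism_def category_functor_def
  proof (intro conjI ballI allI impI, goal_cases)
    case 8
    then show ?case
      by (simp add: meet_to_category[OF S] meet_to_category[OF T] F_id F_mult S.identity_in)
  next
    case (9 s e)
    then have "F e \<preceq>\<^bsub>T\<^esub> D T (F s)" using F_mono[of e "D S s"] F_D by simp
    with 9 show ?case
      by (simp add: restrict_D_to_category[OF S] restrict_D_to_category[OF T] F_id F_in F_mult
          S.identity_in)
  next
    case (10 s e)
    then have "F e \<preceq>\<^bsub>T\<^esub> R T (F s)" using F_mono[of e "R S s"] F_R by simp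
    with 10 show ?case
      by (simp add: restrict_R_to_category[OF S] restrict_R_to_category[OF T] F_id F_in F_mult
          S.identity_in)
  qed (auto simp: F_in F_D F_R F_mono F_mult CS.category_axioms CT.category_axioms
      split: if_splits simp flip: F_D F_R)
qed

lemma morphism_imp_hom:
  assumes C: "ehresmann_ordered_category C" and C': "ehresmann_ordered_category C'"
    and F: "ehresmann_ordered_morphism C C' F"
  shows "ordered_ehresmann_hom (to_semigroup C) (to_semigroup C') F"
proof -
  interpret C: ehresmann_ordered_category C by fact
  interpret C': ehresmann_ordered_category C' by fact
  note F' = F[unfolded ehresmann_ordered_morphism_def category_functor_def]
  have F_in: "F x \<in> carrier C'" if "x \<in> carrier C" for x
    using F' that by auto
  have F_mult: "F (pseudoproduct C s t) = pseudoproduct C' (F s) (F t)"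
    if st: "s \<in> carrier C" "t \<in> carrier C" for s t
  proof -
    define e where "e = meet C (R C s) (D C t)"
    have e: "e \<in> identities C" "e \<sqsubseteq>\<^bsub>C\<^esub> R C s" "e \<sqsubseteq>\<^bsub>C\<^esub> D C t"
      using st C.meet C.D_identity C.R_identity by (auto simp: e_def)
    have Fe: "F e = meet C' (R C' (F s)) (D C' (F t))"
      using F' st by (simp add: e_def C.D_identity C.R_identity)
    have "F (restrict_R C s e) \<odot>\<^bsub>C'\<^esub> F (restrict_D C e t) = Some (F (pseudoproduct C s t))"
      using F' C.pseudoproduct_Some[OF st e_def] by blast
    then have "restrict_R C' (F s) (F e) \<odot>\<^bsub>C'\<^esub> restrict_D C' (F e) (F t)
        = Some (F (pseudoproduct C s t))"
      using F' st e by simp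
    then show ?thesis
      using C'.pseudoproduct_Some[OF F_in F_in Fe] st by simp
  qed
  show ?thesis
    unfolding ordered_ehresmann_hom_def using F' F_mult F_in by simp
qed

text \<open>
  Morphisms of Ehresmann-ordered categories inherit identities and composites from semigroup
  homomorphisms through this equivalence.
\<close>

lemma morphism_iff_hom:
  assumes "ehresmann_ordered_category C" "ehresmann_ordered_category C'"
  shows "ehresmann_ordered_morphism C C' F
    \<longleftrightarrow> ordered_ehresmann_hom (to_semigroup C) (to_semigroup C') F"
  using assms morphism_imp_hom hom_imp_morphism ordered_ehresmann_semigroup_to_semigroup
    to_category_to_semigroup by metis

section \<open>Categories of structures\<close>

locale concrete_category =
  fixes ob :: "('a, 'm) biunary_scheme \<Rightarrow> bool"
    and hm :: "('a, 'm) biunary_scheme \<Rightarrow> ('a, 'm) biunary_scheme \<Rightarrow> ('a \<Rightarrow> 'a) \<Rightarrow> bool"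
  assumes hom_maps: "\<lbrakk>ob S; ob T; hm S T F\<rbrakk> \<Longrightarrow> F \<in> carrier S \<rightarrow> carrier T"
    and hom_identity: "ob S \<Longrightarrow> hm S S (\<lambda>x\<in>carrier S. x)"
    and hom_compose: "\<lbrakk>ob S; ob T; ob U; hm S T F; hm T U G\<rbrakk> \<Longrightarrow> hm S U (compose (carrier S) G F)"
begin

lemma category_structure_category: "category (structure_category ob hm)"
proof -
  have id: "identity_arrow S \<in> arrows ob hm" if "ob S" for S
    using that hom_identity by (auto simp: arrows_def identity_arrow_def)
  have comp: "(S, compose (carrier S) G F, U) \<in> arrows ob hm"
    if "(S, F, T) \<in> arrows ob hm" "(T, G, U) \<in> arrows ob hm" for S F T G U
    using that hom_compose by (auto simp: arrows_def)
  have ob: "ob S \<and> ob T \<and> F \<in> extensional (carrier S) \<and> F \<in> carrier S \<rightarrow> carrier T"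
    if "(S, F, T) \<in> arrows ob hm" for S F T
    using that hom_maps by (auto simp: arrows_def)
  show ?thesis
  proof (unfold_locales, goal_cases)
    case 1 then show ?case using id ob by (auto simp: structure_category_def split: prod.splits)
  next
    case 2 then show ?case using id ob by (auto simp: structure_category_def split: prod.splits)
  next
    case 3 then show ?case
      using comp by (auto simp: structure_category_def split: prod.splits if_splits)
  next
    case 4 then show ?case
      by (auto simp: structure_category_def identity_arrow_def split: prod.splits if_splits)
  next
    case (5 x) then show ?case
      using id ob compose_Id
      by (cases x) (fastforce simp: structure_category_def identity_arrow_def split: prod.splits)
  next
    case (6 x) then show ?case
      using id ob Id_compose
      by (cases x) (fastforce simp: structure_category_def identity_arrow_def split: prod.splits)
  next
    case (7 x) then show ?case
      using id ob by (cases x) (auto simp: structure_category_def identity_arrow_def)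
  next
    case (8 x) then show ?case
      using id ob by (cases x) (auto simp: structure_category_def identity_arrow_def)
  next
    case 9 then show ?case
      using comp by (auto simp: structure_category_def split: prod.splits if_splits)
  next
    case 10 then show ?case
      using comp by (auto simp: structure_category_def split: prod.splits if_splits)
  next
    case (11 x y xy z u yz v)
    then obtain S F T G U H V where
      "x = (S, F, T)" "y = (T, G, U)" "z = (U, H, V)" "(S, F, T) \<in> arrows ob hm"
      by (auto simp: structure_category_def split: prod.splits if_splits)
    with 11 show ?case
      using compose_assoc[of F "carrier S" "carrier T" H G] ob[of S F T]
      by (auto simp: structure_category_def split: if_splits)
  qed
qed

end

text \<open>
  The underlying maps are left unchanged, and composites and identity arrows depend on the
  structures only through the carriers; so keeping the carriers is enough for functoriality.
\<close>

lemma functor_structure_category: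
  assumes "concrete_category ob hm" "concrete_category ob' hm'"
    and carrier: "\<And>S. ob S \<Longrightarrow> carrier (\<Phi> S) = carrier S"
    and ob: "\<And>S. ob S \<Longrightarrow> ob' (\<Phi> S)"
    and hom: "\<And>S T F. \<lbrakk>ob S; ob T; hm S T F\<rbrakk> \<Longrightarrow> hm' (\<Phi> S) (\<Phi> T) F"
  shows "category_functor (structure_category ob hm) (structure_category ob' hm')
    (\<lambda>(S, F, T). (\<Phi> S, F, \<Phi> T))"
proof -
  interpret A: concrete_category ob hm by fact
  interpret B: concrete_category ob' hm' by fact
  have arr: "(\<Phi> S, F, \<Phi> T) \<in> arrows ob' hm'" if "(S, F, T) \<in> arrows ob hm" for S F T
    using that assms(3-5) by (auto simp: arrows_def)
  have obs: "ob S \<and> ob T" if "(S, F, T) \<in> arrows ob hm" for S F T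
    using that by (auto simp: arrows_def)
  show ?thesis
    unfolding category_functor_def
    using arr obs A.category_structure_category B.category_structure_category
    by (auto simp: structure_category_def identity_arrow_def carrier split: if_splits)
qed

lemma concrete_category_semigroups:
  "concrete_category (ordered_ehresmann_semigroup :: 'a ordered_semigroup \<Rightarrow> bool)
     ordered_ehresmann_hom"
proof (unfold_locales, goal_cases)
  case (1 S T F) then show ?case by (simp add: ordered_ehresmann_hom_def)
next
  case (2 S)
  then interpret ordered_ehresmann_semigroup S .
  show ?case
    by (auto simp: ordered_ehresmann_hom_def mult_in D_in R_in sle_in_left sle_in_right)
next
  case (3 S T U F G)
  then interpret ordered_ehresmann_semigroup S by simp
  show ?case
    using 3(4,5) unfolding ordered_ehresmann_hom_def
    by (auto simp: compose_eq mult_in D_in R_in sle_in_left sle_in_right Pi_iff compose_def)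
qed

lemma concrete_category_categories:
  "concrete_category (ehresmann_ordered_category :: 'a ordered_cat \<Rightarrow> bool)
     ehresmann_ordered_morphism"
proof (unfold_locales, goal_cases)
  case (1 S T F) then show ?case
    by (simp add: ehresmann_ordered_morphism_def category_functor_def)
next
  case (2 S) then show ?case
    using concrete_category.hom_identity[OF concrete_category_semigroups, of "to_semigroup S"]
    by (simp add: morphism_iff_hom ordered_ehresmann_semigroup_to_semigroup)
next
  case (3 S T U F G) then show ?case
    using concrete_category.hom_compose[OF concrete_category_semigroups,
        of "to_semigroup S" "to_semigroup T" "to_semigroup U" F G]
    by (simp add: morphism_iff_hom ordered_ehresmann_semigroup_to_semigroup)
qed

theorem theorem4p7:
  shows "(\<forall>S :: 'a ordered_semigroup. ordered_ehresmann_semigroup S \<longrightarrow>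
            ehresmann_ordered_category (to_category S) \<and> to_semigroup (to_category S) = S) \<and>
         (\<forall>C :: 'a ordered_cat. ehresmann_ordered_category C \<longrightarrow>
            ordered_ehresmann_semigroup (to_semigroup C) \<and> to_category (to_semigroup C) = C) \<and>
         category_isomorphism ordered_ehresmann_semigroups ehresmann_ordered_categories
           (\<lambda>(S :: 'a ordered_semigroup, F, T). (to_category S, F, to_category T))"
proof (intro conjI allI impI)
  show "category_isomorphism ordered_ehresmann_semigroups ehresmann_ordered_categories
           (\<lambda>(S :: 'a ordered_semigroup, F, T). (to_category S, F, to_category T))"
    (is "category_isomorphism ?A ?B ?F")
    unfolding category_isomorphism_def
  proof (intro conjI exI)
    let ?G = "\<lambda>(C :: 'a ordered_cat, F, C'). (to_semigroup C, F, to_semigroup C')"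
    show "category_functor ?A ?B ?F"
      unfolding ordered_ehresmann_semigroups_def ehresmann_ordered_categories_def
      by (intro functor_structure_category concrete_category_semigroups
          concrete_category_categories ehresmann_ordered_category_to_category hom_imp_morphism)
        simp_all
    show "category_functor ?B ?A ?G"
      unfolding ordered_ehresmann_semigroups_def ehresmann_ordered_categories_def
      by (intro functor_structure_category concrete_category_semigroups
          concrete_category_categories ordered_ehresmann_semigroup_to_semigroup morphism_imp_hom)
        simp_all
    show "\<forall>x\<in>carrier ?A. ?G (?F x) = x"
      by (auto simp: ordered_ehresmann_semigroups_def structure_category_def arrows_def
          to_semigroup_to_category)
    show "\<forall>y\<in>carrier ?B. ?F (?G y) = y"
      by (auto simp: ehresmann_ordered_categories_def structure_category_def arrows_def
          to_category_to_semigroup)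
  qed
qed (simp_all add: ehresmann_ordered_category_to_category to_semigroup_to_category
    ordered_ehresmann_semigroup_to_semigroup to_category_to_semigroup)

end
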